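(* Let $\kappa$ be a regular (infinite) cardinal and let $(X,E)$ be a $\kappa$-saturated model of the theory of the Rado graph with $|X|=\kappa$. Then $(X,E)$ is sunflowerable.
   Context: The theory of the Rado graph is the complete first-order theory of the countable random graph, in the language with one binary relation $E$. A set $Y$ of finite sets is a sunflower if there is a set $r$ such that $p\cap q=r$ for all distinct $p,q\in Y$. For $n\in\omega$, an infinite structure $\mathcal{M}$ is $n$-sunflowerable if for every structure $\mathcal{Y}\cong\mathcal{M}$ all of whose elements are sets of size $n$, there is a substructure $\mathcal{Z}\subseteq\mathcal{Y}$ with $\mathcal{Z}\cong\mathcal{Y}$ whose underlying set $Z$ is a sunflower. $\mathcal{M}$ is sunflowerable if it is $n$-sunflowerable for every $n\in\omega$. *)

theory Defs
  imports Main
begin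

unbundle cardinal_syntax

section \<open>First-order logic in the language with one binary relation\<close>

datatype fm =
    Edge nat nat
  | Equal nat nat
  | Neg fm
  | Conj fm fm
  | Exists nat fm

primrec fv :: "fm \<Rightarrow> nat set" where
  "fv (Edge i j) = {i, j}"
| "fv (Equal i j) = {i, j}"
| "fv (Neg \<phi>) = fv \<phi>"
| "fv (Conj \<phi> \<psi>) = fv \<phi> \<union> fv \<psi>"
| "fv (Exists i \<phi>) = fv \<phi> - {i}"

text \<open>A structure consists of a carrier set \<open>X\<close> and a relation \<open>E\<close> on the ambient type, of which
  only the restriction to \<open>X\<close> matters. A substructure is therefore given by a subset of the
  carrier together with the same \<open>E\<close>.\<close>

primrec sat :: "'a set \<Rightarrow> ('a \<Rightarrow> 'a \<Rightarrow> bool) \<Rightarrow> (nat \<Rightarrow> 'a) \<Rightarrow> fm \<Rightarrow> bool" where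
  "sat X E e (Edge i j) \<longleftrightarrow> E (e i) (e j)"
| "sat X E e (Equal i j) \<longleftrightarrow> e i = e j"
| "sat X E e (Neg \<phi>) \<longleftrightarrow> \<not> sat X E e \<phi>"
| "sat X E e (Conj \<phi> \<psi>) \<longleftrightarrow> sat X E e \<phi> \<and> sat X E e \<psi>"
| "sat X E e (Exists i \<phi>) \<longleftrightarrow> (\<exists>a\<in>X. sat X E (e(i := a)) \<phi>)"

definition sentence :: "fm \<Rightarrow> bool" where
  "sentence \<phi> \<longleftrightarrow> fv \<phi> = {}"

text \<open>Used for sentences only, whose truth value does not depend on the assignment.\<close>

definition holds :: "'a set \<Rightarrow> ('a \<Rightarrow> 'a \<Rightarrow> bool) \<Rightarrow> fm \<Rightarrow> bool" where
  "holds X E \<phi> \<longleftrightarrow> (\<forall>e. sat X E e \<phi>)"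

definition theory_of :: "'a set \<Rightarrow> ('a \<Rightarrow> 'a \<Rightarrow> bool) \<Rightarrow> fm set" where
  "theory_of X E = {\<phi>. sentence \<phi> \<and> holds X E \<phi>}"

definition models :: "'a set \<Rightarrow> ('a \<Rightarrow> 'a \<Rightarrow> bool) \<Rightarrow> fm set \<Rightarrow> bool" where
  "models X E T \<longleftrightarrow> X \<noteq> {} \<and> (\<forall>\<phi>\<in>T. holds X E \<phi>)"


section \<open>The Rado graph\<close>

text \<open>Rado's presentation of the countable random graph, with vertex set the natural numbers:
  distinct \<open>i\<close> and \<open>j\<close> are adjacent iff the binary expansion of one of them has digit 1 at the
  position given by the other. The lemmas below confirm that this is the countable random graph,
  which is characterised up to isomorphism by the extension property.\<close>

definition rado_edge :: "nat \<Rightarrow> nat \<Rightarrow> bool" where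
  "rado_edge i j \<longleftrightarrow> bit i j \<or> bit j i"

lemma rado_edge_sym: "rado_edge i j \<longleftrightarrow> rado_edge j i"
  by (auto simp: rado_edge_def)

lemma not_bit_nat_ge: "i \<le> j \<Longrightarrow> \<not> bit (i :: nat) j"
  by (metis bit_iff_odd div_less even_zero le_less_trans less_exp)

lemma rado_edge_irrefl: "\<not> rado_edge i i"
  by (simp add: rado_edge_def not_bit_nat_ge)

lemma rado_edge_extension:
  assumes "finite U" "finite V" "U \<inter> V = {}"
  shows "\<exists>z. z \<notin> U \<union> V \<and> (\<forall>u\<in>U. rado_edge z u) \<and> (\<forall>v\<in>V. \<not> rado_edge z v)"
proof -
  have *: "\<exists>z::nat. \<forall>k. bit z k \<longleftrightarrow> k \<in> W" if "finite W" for W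
    using that
  proof (induction W)
    case empty
    show ?case by (intro exI[of _ 0]) simp
  next
    case (insert w W)
    then obtain z :: nat where "\<forall>k. bit z k \<longleftrightarrow> k \<in> W" by blast
    then show ?case by (intro exI[of _ "set_bit w z"]) (auto simp: bit_set_bit_iff)
  qed
  obtain m where m: "\<forall>k\<in>U \<union> V. k < m"
    using assms(1,2) finite_nat_set_iff_bounded by (metis finite_UnI)
  obtain z :: nat where z: "\<forall>k. bit z k \<longleftrightarrow> k \<in> insert m U"
    using *[of "insert m U"] assms(1) by auto
  have "m < z" using z not_bit_nat_ge not_le by blast
  show ?thesis
  proof (intro exI[of _ z] conjI ballI)
    show "z \<notin> U \<union> V" using m \<open>m < z\<close> less_asym by blast
    show "rado_edge z u" if "u \<in> U" for u using that z by (simp add: rado_edge_def)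
    show "\<not> rado_edge z v" if "v \<in> V" for v
    proof -
      have "v < m" using that m by blast
      moreover have "v \<notin> U" using that assms(3) by blast
      ultimately show ?thesis
        using z \<open>m < z\<close> not_bit_nat_ge[of v z] by (auto simp: rado_edge_def)
    qed
  qed
qed

definition rado_theory :: "fm set" where
  "rado_theory = theory_of (UNIV :: nat set) rado_edge"


section \<open>Types and saturation\<close>

text \<open>A formula \<open>\<phi>(x, b)\<close> in the single free variable \<open>x\<close> with parameters from \<open>B\<close> is a pair
  \<open>(\<phi>, e)\<close>: the variable 0 of \<open>\<phi>\<close> plays the role of \<open>x\<close>, and \<open>e\<close> assigns elements of \<open>B\<close> to
  the other free variables of \<open>\<phi>\<close>.\<close>

definition param_formulas :: "'a set \<Rightarrow> (fm \<times> (nat \<Rightarrow> 'a)) set" where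
  "param_formulas B = {(\<phi>, e). \<forall>i\<in>fv \<phi> - {0}. e i \<in> B}"

definition realizes ::
  "'a set \<Rightarrow> ('a \<Rightarrow> 'a \<Rightarrow> bool) \<Rightarrow> 'a \<Rightarrow> (fm \<times> (nat \<Rightarrow> 'a)) set \<Rightarrow> bool" where
  "realizes X E c p \<longleftrightarrow> c \<in> X \<and> (\<forall>(\<phi>, e)\<in>p. sat X E (e(0 := c)) \<phi>)"

definition finitely_satisfiable ::
  "'a set \<Rightarrow> ('a \<Rightarrow> 'a \<Rightarrow> bool) \<Rightarrow> (fm \<times> (nat \<Rightarrow> 'a)) set \<Rightarrow> bool" where
  "finitely_satisfiable X E p \<longleftrightarrow> (\<forall>q. q \<subseteq> p \<and> finite q \<longrightarrow> (\<exists>c. realizes X E c q))"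

text \<open>Complete 1-types over \<open>B\<close>: maximal finitely satisfiable sets of formulas over \<open>B\<close>.\<close>

definition complete_type ::
  "'a set \<Rightarrow> ('a \<Rightarrow> 'a \<Rightarrow> bool) \<Rightarrow> 'a set \<Rightarrow> (fm \<times> (nat \<Rightarrow> 'a)) set \<Rightarrow> bool" where
  "complete_type X E B p \<longleftrightarrow>
     p \<subseteq> param_formulas B \<and> finitely_satisfiable X E p \<and>
     (\<forall>q. p \<subseteq> q \<and> q \<subseteq> param_formulas B \<and> finitely_satisfiable X E q \<longrightarrow> q = p)"

definition saturated :: "'k rel \<Rightarrow> 'a set \<Rightarrow> ('a \<Rightarrow> 'a \<Rightarrow> bool) \<Rightarrow> bool" where
  "saturated \<kappa> X E \<longleftrightarrow>
     (\<forall>B p. B \<subseteq> X \<and> |B| <o \<kappa> \<and> complete_type X E B p \<longrightarrow> (\<exists>c. realizes X E c p))"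


section \<open>Sunflowers\<close>

definition sunflower :: "'b set set \<Rightarrow> bool" where
  "sunflower Y \<longleftrightarrow>
     (\<forall>p\<in>Y. finite p) \<and> (\<exists>r. \<forall>p\<in>Y. \<forall>q\<in>Y. p \<noteq> q \<longrightarrow> p \<inter> q = r)"

definition isomorphic ::
  "'a set \<Rightarrow> ('a \<Rightarrow> 'a \<Rightarrow> bool) \<Rightarrow> 'b set \<Rightarrow> ('b \<Rightarrow> 'b \<Rightarrow> bool) \<Rightarrow> bool" where
  "isomorphic X E Y F \<longleftrightarrow>
     (\<exists>f. bij_betw f X Y \<and> (\<forall>x\<in>X. \<forall>y\<in>X. E x y \<longleftrightarrow> F (f x) (f y)))"

text \<open>The type \<open>'b\<close> is the universe from which the elements of the sets \<open>p \<in> Y\<close> are drawn. A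
  statement for a free type variable \<open>'b\<close> covers arbitrary sets. The finiteness requirement
  matters for \<open>n = 0\<close>, since \<open>card\<close> is 0 on infinite sets.\<close>

definition n_sunflowerable ::
  "'b itself \<Rightarrow> nat \<Rightarrow> 'a set \<Rightarrow> ('a \<Rightarrow> 'a \<Rightarrow> bool) \<Rightarrow> bool" where
  "n_sunflowerable TYPE('b) n X E \<longleftrightarrow>
     infinite X \<and>
     (\<forall>(Y :: 'b set set) F.
        (\<forall>p\<in>Y. finite p \<and> card p = n) \<and> isomorphic Y F X E \<longrightarrow>
        (\<exists>Z\<subseteq>Y. isomorphic Z F Y F \<and> sunflower Z))"

definition sunflowerable :: "'b itself \<Rightarrow> 'a set \<Rightarrow> ('a \<Rightarrow> 'a \<Rightarrow> bool) \<Rightarrow> bool" where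
  "sunflowerable TYPE('b) X E \<longleftrightarrow> (\<forall>n. n_sunflowerable TYPE('b) n X E)"

end

theory Submission
  imports Defs
begin

text \<open>
  A \<open>\<kappa>\<close>-saturated model satisfies the extension property for pairs of disjoint sets of size less
  than \<open>\<kappa>\<close>. This property is inherited by the set of realizers of any such pair, and, since \<open>\<kappa>\<close> is
  regular, by some piece of any partition into fewer than \<open>\<kappa>\<close> pieces; and any set with this property
  contains a copy of every graph of size \<open>\<kappa>\<close>. If some point \<open>a\<close> belongs to the labels of all vertices
  in some set with the extension property, remove \<open>a\<close> from these labels and use induction on \<open>n\<close>.
  Otherwise fewer than \<open>\<kappa>\<close> points never meet all labels of a set with the extension property, so a
  copy of \<open>X\<close> with pairwise disjoint labels can be chosen greedily.
\<close>

section \<open>The extension property\<close>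

text \<open>The witness must lie in \<open>P\<close> itself, so \<open>P\<close> is tested as an
  induced subgraph. When \<open>\<kappa>\<close> is countable, \<open>U\<close> and \<open>V\<close>
  range over finite sets, as in the classical extension property of the random graph.\<close>

definition extension_property :: "'k rel \<Rightarrow> ('a \<Rightarrow> 'a \<Rightarrow> bool) \<Rightarrow> 'a set \<Rightarrow> bool" where
  "extension_property \<kappa> E P \<longleftrightarrow>
     (\<forall>U V. U \<subseteq> P \<and> V \<subseteq> P \<and> U \<inter> V = {} \<and> |U| <o \<kappa> \<and> |V| <o \<kappa> \<longrightarrow>
        (\<exists>z\<in>P. z \<notin> U \<union> V \<and> (\<forall>u\<in>U. E z u) \<and> (\<forall>v\<in>V. \<not> E z v)))"

lemma extension_propertyD:
  assumes "extension_property \<kappa> E P" "U \<subseteq> P" "V \<subseteq> P" "U \<inter> V = {}" "|U| <o \<kappa>" "|V| <o \<kappa>"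
  shows "\<exists>z\<in>P. z \<notin> U \<union> V \<and> (\<forall>u\<in>U. E z u) \<and> (\<forall>v\<in>V. \<not> E z v)"
  using assms unfolding extension_property_def by blast

lemma finite_ordLess_Cinfinite:
  assumes "Cinfinite \<kappa>" "finite A"
  shows "|A| <o \<kappa>"
  using assms by (intro Cfinite_ordLess_Cinfinite) (simp_all add: cfinite_def Field_card_of card_of_card_order_on)

text \<open>A pair inside the set of realizers is merged with the given pair. Realizers avoid
  \<open>U \<union> V\<close>, so the merged sets stay disjoint, and they stay small because
  \<open>\<kappa>\<close> is infinite.\<close>

lemma extension_property_realizers:
  assumes "Cinfinite \<kappa>" and ep: "extension_property \<kappa> E P"
    and UV: "U \<subseteq> P" "V \<subseteq> P" "U \<inter> V = {}" "|U| <o \<kappa>" "|V| <o \<kappa>"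
  shows "extension_property \<kappa> E
           {z\<in>P. z \<notin> U \<union> V \<and> (\<forall>u\<in>U. E z u) \<and> (\<forall>v\<in>V. \<not> E z v)}" (is "extension_property \<kappa> E ?T")
  unfolding extension_property_def
proof (intro allI impI, elim conjE)
  fix U' V' assume *: "U' \<subseteq> ?T" "V' \<subseteq> ?T" "U' \<inter> V' = {}" "|U'| <o \<kappa>" "|V'| <o \<kappa>"
  have small: "|U \<union> U'| <o \<kappa>" "|V \<union> V'| <o \<kappa>"
    using assms(1) UV(4,5) *(4,5) card_of_Un_ordLess_infinite_Field unfolding cinfinite_def by blast+
  have "U \<union> U' \<subseteq> P" "V \<union> V' \<subseteq> P" "(U \<union> U') \<inter> (V \<union> V') = {}" using UV(1-3) *(1-3) by blast+
  from extension_propertyD[OF ep this small] obtain z where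
    "z \<in> P" "z \<notin> (U \<union> U') \<union> (V \<union> V')" "\<forall>u\<in>U \<union> U'. E z u" "\<forall>v\<in>V \<union> V'. \<not> E z v"
    by blast
  then show "\<exists>z\<in>?T. z \<notin> U' \<union> V' \<and> (\<forall>u\<in>U'. E z u) \<and> (\<forall>v\<in>V'. \<not> E z v)" by blast
qed

text \<open>Witnesses \<open>U\<close>, \<open>V\<close> against the extension property in the individual pieces combine to a
  pair without realizer in the whole set.\<close>

lemma extension_property_partition:
  assumes "Cinfinite \<kappa>" "regularCard \<kappa>" and ep: "extension_property \<kappa> E P"
    and h: "h ` P \<subseteq> A" and A: "|A| <o \<kappa>"
  shows "\<exists>a\<in>A. extension_property \<kappa> E {x\<in>P. h x = a}"
proof (rule ccontr)
  let ?p = "\<lambda>a. {x\<in>P. h x = a}"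
  define bad where "bad a U V \<longleftrightarrow> U \<subseteq> ?p a \<and> V \<subseteq> ?p a \<and> U \<inter> V = {} \<and> |U| <o \<kappa> \<and> |V| <o \<kappa> \<and>
    \<not> (\<exists>z\<in>?p a. z \<notin> U \<union> V \<and> (\<forall>u\<in>U. E z u) \<and> (\<forall>v\<in>V. \<not> E z v))" for a U V
  assume "\<not> ?thesis"
  then have "\<forall>a\<in>A. \<exists>U V. bad a U V"
    by (simp only: extension_property_def bad_def not_all not_imp bex_simps conj_assoc)
  then obtain U V where "\<And>a. a \<in> A \<Longrightarrow> bad a (U a) (V a)" by metis
  then have U: "U a \<subseteq> ?p a" and V: "V a \<subseteq> ?p a" and disj: "U a \<inter> V a = {}"
    and sUV: "|U a| <o \<kappa>" "|V a| <o \<kappa>"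
    and no_realizer: "\<not> (\<exists>z\<in>?p a. z \<notin> U a \<union> V a \<and> (\<forall>u\<in>U a. E z u) \<and> (\<forall>v\<in>V a. \<not> E z v))"
    if "a \<in> A" for a
    using that unfolding bad_def by simp_all
  \<comment> \<open>Regularity enters here: both unions of fewer than \<open>\<kappa>\<close> small
    sets are small.\<close>
  have small: "|\<Union>a\<in>A. U a| <o \<kappa>" "|\<Union>a\<in>A. V a| <o \<kappa>"
    using regularCard_UNION_bound[OF assms(1,2) A, of U] regularCard_UNION_bound[OF assms(1,2) A, of V] sUV
    by simp_all
  have "(\<Union>a\<in>A. U a) \<subseteq> P" "(\<Union>a\<in>A. V a) \<subseteq> P"
    by (rule UN_least, use U V in auto)+
  moreover have "(\<Union>a\<in>A. U a) \<inter> (\<Union>a\<in>A. V a) = {}"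
  proof -
    have "x \<notin> V b" if "a \<in> A" "b \<in> A" "x \<in> U a" for a b x
    proof
      assume "x \<in> V b"
      then have "h x = a" "h x = b" using U[OF that(1)] V[OF that(2)] that(3) by auto
      then show False using disj[OF that(1)] that(3) \<open>x \<in> V b\<close> by auto
    qed
    then show ?thesis by blast
  qed
  ultimately have "\<exists>z\<in>P. z \<notin> (\<Union>a\<in>A. U a) \<union> (\<Union>a\<in>A. V a) \<and>
      (\<forall>u\<in>(\<Union>a\<in>A. U a). E z u) \<and> (\<forall>v\<in>(\<Union>a\<in>A. V a). \<not> E z v)"
    using small by (intro extension_propertyD[OF ep])
  then obtain z where z: "z \<in> P" "z \<notin> (\<Union>a\<in>A. U a) \<union> (\<Union>a\<in>A. V a)"
      "\<forall>u\<in>(\<Union>a\<in>A. U a). E z u" "\<forall>v\<in>(\<Union>a\<in>A. V a). \<not> E z v"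
    by (elim bexE conjE)
  \<comment> \<open>The witness \<open>z\<close> falls into the piece of \<open>h z\<close>, where
    it realizes the very pair chosen to have no realizer.\<close>
  have hz: "h z \<in> A" using z(1) h by blast
  have "\<exists>w\<in>?p (h z). w \<notin> U (h z) \<union> V (h z) \<and> (\<forall>u\<in>U (h z). E w u) \<and> (\<forall>v\<in>V (h z). \<not> E w v)"
    using hz z by (intro bexI[of _ z]) auto
  then show False using no_realizer[OF hz] by contradiction
qed


section \<open>Copies with sunflower labels\<close>

definition graph_embedding :: "'a set \<Rightarrow> ('a \<Rightarrow> 'a \<Rightarrow> bool) \<Rightarrow> 'a set \<Rightarrow> ('a \<Rightarrow> 'a) \<Rightarrow> bool" where
  "graph_embedding X E P g \<longleftrightarrow>
     g ` X \<subseteq> P \<and> inj_on g X \<and> (\<forall>x\<in>X. \<forall>y\<in>X. E x y \<longleftrightarrow> E (g x) (g y))"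

text \<open>Transfinite recursion along a well-order of \<open>X\<close> whose proper initial
  segments are smaller than \<open>\<kappa>\<close>. At each stage the earlier images form a small
  pair and their labels cover a small set of points. The hypothesis \<open>avoid\<close> handles one
  point at a time; the partition lemma extends it to a small set.\<close>

lemma greedy_embedding:
  fixes f :: "'a \<Rightarrow> 'b set"
  assumes \<kappa>: "Cinfinite \<kappa>" "regularCard \<kappa>" and X: "|X| =o \<kappa>"
    and sym: "\<And>x y. x \<in> X \<Longrightarrow> y \<in> X \<Longrightarrow> E x y \<longleftrightarrow> E y x" and irr: "\<And>x. x \<in> X \<Longrightarrow> \<not> E x x"
    and P: "P \<subseteq> X" "extension_property \<kappa> E P"
    and fin: "\<And>x. x \<in> P \<Longrightarrow> finite (f x)"
    and avoid: "\<And>a P'. P' \<subseteq> P \<Longrightarrow> extension_property \<kappa> E P' \<Longrightarrow> \<exists>x\<in>P'. a \<notin> f x"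
  shows "\<exists>g. graph_embedding X E P g \<and> (\<forall>x\<in>X. \<forall>y\<in>X. x \<noteq> y \<longrightarrow> f (g x) \<inter> f (g y) = {})"
proof -
  define R where "R = |X| - Id"
  have wo: "Well_order |X|" by (rule card_of_Well_order)
  have fld: "Field |X| = X" by (rule Field_card_of)
  have wf: "wf R" unfolding R_def using wo by (simp add: well_order_on_def)
  have RX: "x \<in> X" "y \<in> X" if "(y, x) \<in> R" for x y
    using that fld unfolding R_def Field_def by blast+
  have total: "(x, y) \<in> R \<or> (y, x) \<in> R" if "x \<in> X" "y \<in> X" "x \<noteq> y" for x y
    using that wo fld unfolding R_def well_order_on_def linear_order_on_def total_on_def by auto
  have small: "|{y. (y, x) \<in> R}| <o \<kappa>" if "x \<in> X" for x
  proof -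
    \<comment> \<open>\<open>|X|\<close> is a cardinal order, so its proper initial segments have
      smaller cardinality than \<open>X\<close>.\<close>
    have "{y. (y, x) \<in> R} = underS |X| x" unfolding R_def underS_def by auto
    then show ?thesis
      using card_of_underS[OF card_of_Card_order, of x X] that fld X ordLess_ordIso_trans by metis
  qed
  \<comment> \<open>The recursion runs over the whole type, hence the vacuous case outside
    \<open>X\<close>. Only edges from \<open>x\<close> to earlier vertices are controlled; symmetry
    supplies the other direction afterwards.\<close>
  define Q where "Q g x z \<longleftrightarrow> (x \<in> X \<longrightarrow> z \<in> P \<and>
      (\<forall>y. (y, x) \<in> R \<longrightarrow> z \<noteq> g y \<and> (E x y \<longleftrightarrow> E z (g y)) \<and> f z \<inter> f (g y) = {}))" for g x z
  have "\<exists>g. \<forall>x. Q g x (g x)"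
  proof (rule dependent_wf_choice[OF wf])
    show "Q g x z = Q g' x z" if "\<And>y. (y, x) \<in> R \<Longrightarrow> g y = g' y" for g g' x z
      using that unfolding Q_def by auto
  next
    fix x g assume IH: "\<And>y. (y, x) \<in> R \<Longrightarrow> Q g y (g y)"
    show "\<exists>z. Q g x z"
    proof (cases "x \<in> X")
      case True
      let ?S = "{y. (y, x) \<in> R}"
      define U where "U = g ` {y\<in>?S. E x y}"
      define V where "V = g ` {y\<in>?S. \<not> E x y}"
      define A where "A = (\<Union>y\<in>?S. f (g y))"
      define T where "T = {z\<in>P. z \<notin> U \<union> V \<and> (\<forall>u\<in>U. E z u) \<and> (\<forall>v\<in>V. \<not> E z v)}"
      have gP: "g y \<in> P" if "y \<in> ?S" for y using IH[of y] that RX unfolding Q_def by blast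
      have ginj: "g y \<noteq> g y'" if "y \<in> ?S" "y' \<in> ?S" "y \<noteq> y'" for y y'
        using IH[of y] IH[of y'] that RX total[of y y'] unfolding Q_def by fastforce
      have UV: "U \<subseteq> P" "V \<subseteq> P" using gP unfolding U_def V_def by blast+
      have disj: "U \<inter> V = {}" using ginj unfolding U_def V_def by fastforce
      have sub: "|g ` S'| <o \<kappa>" if "S' \<subseteq> ?S" for S'
        using card_of_image[of g S'] card_of_mono1[OF that] small[OF True]
          ordLeq_ordLess_trans by blast
      have sUV: "|U| <o \<kappa>" "|V| <o \<kappa>" unfolding U_def V_def by (rule sub; blast)+
      have T: "extension_property \<kappa> E T"
        unfolding T_def by (rule extension_property_realizers[OF \<kappa>(1) P(2) UV disj sUV])
      have sA: "|A| <o \<kappa>"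
        unfolding A_def
        by (intro regularCard_UNION_bound[OF \<kappa> small[OF True]] finite_ordLess_Cinfinite[OF \<kappa>(1)] fin gP)
      \<comment> \<open>Otherwise, choosing a point \<open>h z\<close> of \<open>A\<close> in the
        label of each realizer splits \<open>T\<close> into fewer than \<open>\<kappa>\<close>
        pieces. One piece keeps the extension property, and all its labels share a point, against
        \<open>avoid\<close>.\<close>
      have "\<exists>z\<in>T. f z \<inter> A = {}"
      proof (rule ccontr)
        assume "\<not> ?thesis"
        then have "\<forall>z\<in>T. \<exists>a. a \<in> f z \<inter> A" by blast
        then obtain h where h: "\<And>z. z \<in> T \<Longrightarrow> h z \<in> f z \<inter> A" by metis
        then have "h ` T \<subseteq> A" by blast
        from extension_property_partition[OF \<kappa> T this sA] obtain a
          where a: "extension_property \<kappa> E {z\<in>T. h z = a}" by blast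
        have "{z\<in>T. h z = a} \<subseteq> P" unfolding T_def by blast
        from avoid[OF this a, of a] h show False by blast
      qed
      then obtain z where z: "z \<in> T" "f z \<inter> A = {}" by blast
      have "Q g x z"
        using z unfolding Q_def T_def U_def V_def A_def by fastforce
      then show ?thesis by blast
    qed (simp add: Q_def)
  qed
  then obtain g where g: "\<And>x. Q g x (g x)" by blast
  have gP: "g x \<in> P" if "x \<in> X" for x using g[of x] that unfolding Q_def by blast
  have step: "g x \<noteq> g y \<and> (E x y \<longleftrightarrow> E (g x) (g y)) \<and> f (g x) \<inter> f (g y) = {}"
    if "(y, x) \<in> R" for x y using g[of x] that RX(1)[OF that] unfolding Q_def by blast
  have both: "g x \<noteq> g y \<and> (E x y \<longleftrightarrow> E (g x) (g y)) \<and> f (g x) \<inter> f (g y) = {}"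
    if "x \<in> X" "y \<in> X" "x \<noteq> y" for x y
  proof (cases "(y, x) \<in> R")
    case False
    then have "(x, y) \<in> R" using total that by blast
    \<comment> \<open>Symmetry is available only on \<open>X\<close>; it applies to the images
      because \<open>P \<subseteq> X\<close>.\<close>
    moreover have "g x \<in> X" "g y \<in> X" using gP P(1) that by blast+
    ultimately show ?thesis using step[of x y] sym[of x y] sym[of "g x" "g y"] that by (auto simp: Int_commute)
  qed (rule step)
  have "E x y \<longleftrightarrow> E (g x) (g y)" if "x \<in> X" "y \<in> X" for x y
    using both[OF that] irr gP P(1) that by (cases "x = y") blast+
  then show ?thesis
    unfolding graph_embedding_def inj_on_def using both gP by blast
qed

text \<open>The root collects the points removed during the induction. Both \<open>P\<close> and
  \<open>f\<close> vary, since the inductive step passes to a subset \<open>P'\<close> and to the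
  labels \<open>f x - {a}\<close>, which have one element fewer.\<close>

lemma sunflower_embedding:
  fixes f :: "'a \<Rightarrow> 'b set"
  assumes \<kappa>: "Cinfinite \<kappa>" "regularCard \<kappa>" and X: "|X| =o \<kappa>"
    and sym: "\<And>x y. x \<in> X \<Longrightarrow> y \<in> X \<Longrightarrow> E x y \<longleftrightarrow> E y x" and irr: "\<And>x. x \<in> X \<Longrightarrow> \<not> E x x"
    and P: "P \<subseteq> X" "extension_property \<kappa> E P"
    and f: "\<And>x. x \<in> P \<Longrightarrow> finite (f x) \<and> card (f x) = n"
  shows "\<exists>g r. graph_embedding X E P g \<and> (\<forall>x\<in>X. \<forall>y\<in>X. x \<noteq> y \<longrightarrow> f (g x) \<inter> f (g y) = r)"
  using P f
proof (induction n arbitrary: P f)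
  case 0
  have "a \<notin> f x" if "x \<in> P" for a x using 0(3)[OF that] by auto
  \<comment> \<open>The empty pair has a realizer, so \<open>avoid\<close> holds for empty
    labels.\<close>
  moreover have "P' \<noteq> {}" if "extension_property \<kappa> E P'" for P'
    using extension_propertyD[OF that, of "{}" "{}"] finite_ordLess_Cinfinite[OF \<kappa>(1)] by blast
  ultimately have avoid: "\<exists>x\<in>P'. a \<notin> f x" if "P' \<subseteq> P" "extension_property \<kappa> E P'" for a P'
    using that by blast
  have "\<exists>g. graph_embedding X E P g \<and> (\<forall>x\<in>X. \<forall>y\<in>X. x \<noteq> y \<longrightarrow> f (g x) \<inter> f (g y) = {})"
    by (rule greedy_embedding[OF \<kappa> X sym irr 0(1,2) _ avoid]) (use 0(3) in auto)
  then show ?case by blast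
next
  case (Suc n)
  show ?case
  proof (cases "\<exists>a P'. P' \<subseteq> P \<and> extension_property \<kappa> E P' \<and> (\<forall>x\<in>P'. a \<in> f x)")
    case True
    then obtain a P' where P': "P' \<subseteq> P" "extension_property \<kappa> E P'" "\<And>x. x \<in> P' \<Longrightarrow> a \<in> f x"
      by blast
    have "\<exists>g r. graph_embedding X E P' g \<and>
        (\<forall>x\<in>X. \<forall>y\<in>X. x \<noteq> y \<longrightarrow> (f (g x) - {a}) \<inter> (f (g y) - {a}) = r)"
    proof (rule Suc.IH)
      show "P' \<subseteq> X" using P'(1) Suc.prems(1) by blast
      show "finite (f x - {a}) \<and> card (f x - {a}) = n" if "x \<in> P'" for x
        using P'(3)[OF that] Suc.prems(3)[of x] P'(1) that by auto
    qed (rule P'(2))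
    then obtain g r where g: "graph_embedding X E P' g"
        "\<forall>x\<in>X. \<forall>y\<in>X. x \<noteq> y \<longrightarrow> (f (g x) - {a}) \<inter> (f (g y) - {a}) = r"
      by blast
    \<comment> \<open>Every image lies in \<open>P'\<close>, so restoring \<open>a\<close> to the
      labels adds it to each pairwise intersection.\<close>
    have "f (g x) \<inter> f (g y) = insert a r" if "x \<in> X" "y \<in> X" "x \<noteq> y" for x y
    proof -
      have "a \<in> f (g x)" "a \<in> f (g y)"
        using g(1) P'(3) that unfolding graph_embedding_def by blast+
      then show ?thesis using g(2)[rule_format, OF that] by blast
    qed
    moreover have "graph_embedding X E P g"
      using g(1) P'(1) unfolding graph_embedding_def by blast
    ultimately show ?thesis by blast
  next
    case False
    have avoid: "\<exists>x\<in>P'. a \<notin> f x" if "P' \<subseteq> P" "extension_property \<kappa> E P'" for a P'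
      using False that by blast
    have "\<exists>g. graph_embedding X E P g \<and> (\<forall>x\<in>X. \<forall>y\<in>X. x \<noteq> y \<longrightarrow> f (g x) \<inter> f (g y) = {})"
      by (rule greedy_embedding[OF \<kappa> X sym irr Suc.prems(1,2) _ avoid]) (use Suc.prems(3) in auto)
    then show ?thesis by blast
  qed
qed


section \<open>Saturated models of the theory of the Rado graph\<close>

lemma models_rado_theoryD:
  assumes "models X E rado_theory" "fv \<phi> = {}" "\<And>e. sat UNIV rado_edge e \<phi>"
  shows "sat X E e \<phi>"
  using assms unfolding models_def rado_theory_def theory_of_def sentence_def holds_def by blast

text \<open>Quantification over a list of variables, because the sentence for the finite extension
  property has as many quantifiers as the sizes of the two sets require.\<close>

definition exs :: "nat list \<Rightarrow> fm \<Rightarrow> fm" where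
  "exs is \<phi> = foldr Exists is \<phi>"

lemma fv_exs: "fv (exs is \<phi>) = fv \<phi> - set is"
  by (induction "is") (auto simp: exs_def)

lemma sat_exs:
  "sat X E e (exs is \<phi>) \<longleftrightarrow>
     (\<exists>e'. (\<forall>i\<in>set is. e' i \<in> X) \<and> (\<forall>i. i \<notin> set is \<longrightarrow> e' i = e i) \<and> sat X E e' \<phi>)"
proof (induction "is" arbitrary: e)
  case Nil
  have "(\<forall>i. e' i = e i) \<longleftrightarrow> e' = e" for e' by auto
  then show ?case by (simp add: exs_def)
next
  case (Cons j js)
  have "sat X E e (exs (j # js) \<phi>) \<longleftrightarrow> (\<exists>a\<in>X. \<exists>e'. (\<forall>i\<in>set js. e' i \<in> X) \<and>
      (\<forall>i. i \<notin> set js \<longrightarrow> e' i = (e(j := a)) i) \<and> sat X E e' \<phi>)"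
    using Cons.IH by (simp add: exs_def)
  also have "\<dots> \<longleftrightarrow> (\<exists>e'. (\<forall>i\<in>set (j # js). e' i \<in> X) \<and>
      (\<forall>i. i \<notin> set (j # js) \<longrightarrow> e' i = e i) \<and> sat X E e' \<phi>)" (is "?L \<longleftrightarrow> ?R")
  proof
    assume ?L
    then obtain a e' where *: "a \<in> X" "\<And>i. i \<in> set js \<Longrightarrow> e' i \<in> X"
      "\<And>i. i \<notin> set js \<Longrightarrow> e' i = (e(j := a)) i" "sat X E e' \<phi>" by blast
    \<comment> \<open>If \<open>j\<close> occurs again in \<open>js\<close>, the inner quantifier
      overrides \<open>a\<close>.\<close>
    have "e' j \<in> X" using * by (cases "j \<in> set js") auto
    then show ?R using * by (intro exI[of _ e']) auto
  next
    assume ?R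
    then obtain e' where "\<And>i. i \<in> set (j # js) \<Longrightarrow> e' i \<in> X"
      "\<And>i. i \<notin> set (j # js) \<Longrightarrow> e' i = e i" "sat X E e' \<phi>" by blast
    then show ?L by (intro bexI[of _ "e' j"] exI[of _ e']) auto
  qed
  finally show ?case .
qed

text \<open>The empty conjunction is a closed tautology, so it contributes no free variable.\<close>

definition conjs :: "fm list \<Rightarrow> fm" where
  "conjs \<phi>s = foldr Conj \<phi>s (Neg (Exists 0 (Neg (Equal 0 0))))"

lemma fv_conjs: "fv (conjs \<phi>s) = (\<Union>\<phi>\<in>set \<phi>s. fv \<phi>)"
  by (induction \<phi>s) (auto simp: conjs_def)

lemma sat_conjs: "sat X E e (conjs \<phi>s) \<longleftrightarrow> (\<forall>\<phi>\<in>set \<phi>s. sat X E e \<phi>)"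
  by (induction \<phi>s) (auto simp: conjs_def)

section \<open>First-order consequences of the theory of the Rado graph\<close>

lemma rado_theory_irrefl:
  assumes "models X E rado_theory" "x \<in> X"
  shows "\<not> E x x"
proof -
  have "sat X E e (Neg (Exists 0 (Edge 0 0)))" for e
    by (rule models_rado_theoryD[OF assms(1)]) (simp_all add: rado_edge_irrefl)
  then show ?thesis using assms(2) by auto
qed

lemma rado_theory_sym:
  assumes "models X E rado_theory" "x \<in> X" "y \<in> X"
  shows "E x y \<longleftrightarrow> E y x"
proof -
  have "sat X E e (Neg (Exists 0 (Exists 1 (Conj (Edge 0 1) (Neg (Edge 1 0))))))" for e
    by (rule models_rado_theoryD[OF assms(1)]) (auto simp: rado_edge_sym)
  then show ?thesis using assms(2,3) by auto
qed

text \<open>For fixed list lengths the claim is a single sentence, true in Rado's graph by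
  \<open>rado_edge_extension\<close>. It transfers to \<open>X\<close> and is then instantiated at
  enumerations of \<open>U\<close> and \<open>V\<close>.\<close>

lemma rado_theory_finite_extension:
  assumes mod: "models X E rado_theory"
    and "finite U" "finite V" "U \<subseteq> X" "V \<subseteq> X" "U \<inter> V = {}"
  shows "\<exists>z\<in>X. z \<notin> U \<union> V \<and> (\<forall>u\<in>U. E z u) \<and> (\<forall>v\<in>V. \<not> E z v)"
proof -
  obtain us vs where us: "set us = U" and vs: "set vs = V"
    using assms(2,3) finite_list by metis
  \<comment> \<open>Variable 0 is reserved for the realizer; the blocks \<open>I\<close> and
    \<open>J\<close> follow it and stand for the entries of \<open>us\<close> and
    \<open>vs\<close>.\<close>
  define I where "I = [1..<Suc (length us)]"
  define J where "J = [Suc (length us)..<Suc (length us + length vs)]"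
  define \<delta> where "\<delta> = conjs [Neg (Equal i j). i \<leftarrow> I, j \<leftarrow> J]"
  define \<chi> where "\<chi> = conjs ([Neg (Equal 0 i). i \<leftarrow> I @ J] @ [Edge 0 i. i \<leftarrow> I] @
    [Neg (Edge 0 j). j \<leftarrow> J])"
  have z: "0 \<notin> set (I @ J)" unfolding I_def J_def by auto
  have \<delta>: "sat Y F e \<delta> \<longleftrightarrow> e ` set I \<inter> e ` set J = {}"
    for Y :: "'z set" and F e unfolding \<delta>_def sat_conjs by auto
  have \<chi>: "sat Y F (e(0 := c)) \<chi> \<longleftrightarrow> c \<notin> e ` set I \<union> e ` set J \<and>
      (\<forall>u\<in>e ` set I. F c u) \<and> (\<forall>v\<in>e ` set J. \<not> F c v)"
    for Y :: "'z set" and F e c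
  proof -
    have "(e(0 := c)) i = e i" if "i \<in> set I \<union> set J" for i using that z by auto
    then show ?thesis unfolding \<chi>_def sat_conjs by (auto simp: ball_Un)
  qed
  \<comment> \<open>The sentence says that no two disjoint tuples lack a realizer.\<close>
  have "sat X E e (Neg (exs (I @ J) (Conj \<delta> (Neg (Exists 0 \<chi>)))))" for e
  proof (rule models_rado_theoryD[OF mod])
    show "fv (Neg (exs (I @ J) (Conj \<delta> (Neg (Exists 0 \<chi>))))) = {}"
      unfolding \<delta>_def \<chi>_def by (auto simp: fv_exs fv_conjs)
    show "sat UNIV rado_edge e (Neg (exs (I @ J) (Conj \<delta> (Neg (Exists 0 \<chi>)))))" for e
      using rado_edge_extension[of "e' ` set I" "e' ` set J" for e']
      by (auto simp: sat_exs \<delta> \<chi>)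
  qed
  \<comment> \<open>The shifts undo the offsets of the blocks: \<open>I\<close> starts at 1 and
    \<open>J\<close> at \<open>Suc (length us)\<close>.\<close>
  moreover define e where "e i = (if i \<le> length us then us ! (i - 1) else vs ! (i - Suc (length us)))" for i
  have "e ` set I = set us"
  proof -
    have "set I = Suc ` {0..<length us}" unfolding I_def by (simp add: image_Suc_atLeastLessThan del: upt_Suc)
    then have "e ` set I = (!) us ` {0..<length us}" by (force simp: image_image e_def)
    then show ?thesis by (metis list.set_map map_nth set_upt)
  qed
  then have eI: "e ` set I = U" using us by simp
  have "e ` set J = set vs"
  proof -
    have "set J = (+) (Suc (length us)) ` {0..<length vs}"
      using image_add_atLeastLessThan[of "Suc (length us)" 0 "length vs"]
      by (simp add: J_def add.commute del: upt_Suc)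
    then have "e ` set J = (!) vs ` {0..<length vs}"
      by (simp only: image_image) (simp add: e_def)
    then show ?thesis by (metis list.set_map map_nth set_upt)
  qed
  then have eJ: "e ` set J = V" using vs by simp
  \<comment> \<open>In \<open>sat_exs\<close> the assignment \<open>e\<close> itself serves as the
    witness, as its values on both blocks lie in \<open>X\<close>.\<close>
  ultimately have "\<not> (sat X E e \<delta> \<and> \<not> (\<exists>c\<in>X. sat X E (e(0 := c)) \<chi>))"
    using assms(4,5) eI eJ unfolding sat.simps sat_exs by fastforce
  then show ?thesis using assms(6) eI eJ unfolding \<delta> \<chi> by blast
qed

section \<open>From saturation to the extension property\<close>

text \<open>Zorn's lemma applies because a finite subset of the union of a chain lies in one member.
  The extension is needed since \<open>saturated\<close> speaks of complete types only.\<close>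

lemma finitely_satisfiable_extends_to_complete_type:
  assumes "p \<subseteq> param_formulas B" "finitely_satisfiable X E p"
  shows "\<exists>q. p \<subseteq> q \<and> complete_type X E B q"
proof -
  define A where "A = {q. p \<subseteq> q \<and> q \<subseteq> param_formulas B \<and> finitely_satisfiable X E q}"
  have "\<exists>M\<in>A. \<forall>q\<in>A. M \<subseteq> q \<longrightarrow> q = M"
  proof (rule subset_Zorn_nonempty)
    show "A \<noteq> {}" using assms unfolding A_def by blast
    fix C assume C: "C \<noteq> {}" "subset.chain A C"
    have CA: "C \<subseteq> A" using C(2) unfolding subset.chain_def by blast
    have "finitely_satisfiable X E (\<Union>C)"
      unfolding finitely_satisfiable_def
    proof (intro allI impI, elim conjE)
      fix q assume "q \<subseteq> \<Union>C" "finite q"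
      then obtain D where "D \<in> C" "q \<subseteq> D"
        using finite_subset_Union_chain[OF _ _ C] by metis
      then show "\<exists>c. realizes X E c q"
        using CA \<open>finite q\<close> unfolding A_def finitely_satisfiable_def by blast
    qed
    then show "\<Union>C \<in> A" using C(1) CA unfolding A_def by blast
  qed
  then obtain M where M: "M \<in> A" "\<And>q. q \<in> A \<Longrightarrow> M \<subseteq> q \<Longrightarrow> q = M" by blast
  have "complete_type X E B M"
    unfolding complete_type_def
  proof (intro conjI allI impI)
    show "q = M" if "M \<subseteq> q \<and> q \<subseteq> param_formulas B \<and> finitely_satisfiable X E q" for q
      using M(1) that unfolding A_def by (intro M(2)) (auto simp: A_def)
  qed (use M(1) in \<open>auto simp: A_def\<close>)
  then show ?thesis using M(1) unfolding A_def by blast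
qed

text \<open>The requirements on a realizer form a set of formulas over the small set
  \<open>U \<union> V\<close>. The finite extension property makes it finitely satisfiable, and
  saturation realizes a completion of it.\<close>

lemma saturated_rado_extension_property:
  fixes X :: "'a set"
  assumes \<kappa>: "Cinfinite \<kappa>" and mod: "models X E rado_theory" and sat: "saturated \<kappa> X E"
  shows "extension_property \<kappa> E X"
  unfolding extension_property_def
proof (intro allI impI, elim conjE)
  fix U V assume UV: "U \<subseteq> X" "V \<subseteq> X" "U \<inter> V = {}" "|U| <o \<kappa>" "|V| <o \<kappa>"
  \<comment> \<open>Variable 1 carries the parameter. The inequality is part of the formula because
    the realizer must lie outside \<open>U \<union> V\<close>.\<close>
  define \<alpha> :: "'a \<Rightarrow> fm \<times> (nat \<Rightarrow> 'a)"
    where "\<alpha> u = (Conj (Neg (Equal 0 1)) (Edge 0 1), \<lambda>_. u)" for u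
  define \<beta> :: "'a \<Rightarrow> fm \<times> (nat \<Rightarrow> 'a)"
    where "\<beta> v = (Conj (Neg (Equal 0 1)) (Neg (Edge 0 1)), \<lambda>_. v)" for v
  define p where "p = \<alpha> ` U \<union> \<beta> ` V"
  have realizes_iff: "realizes X E c (\<alpha> ` U' \<union> \<beta> ` V') \<longleftrightarrow>
      c \<in> X \<and> c \<notin> U' \<union> V' \<and> (\<forall>u\<in>U'. E c u) \<and> (\<forall>v\<in>V'. \<not> E c v)" for c U' V'
    unfolding realizes_def \<alpha>_def \<beta>_def by (auto simp: ball_Un)
  have small: "|U \<union> V| <o \<kappa>"
    using \<kappa> UV(4,5) card_of_Un_ordLess_infinite_Field unfolding cinfinite_def by blast
  have "p \<subseteq> param_formulas (U \<union> V)"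
    unfolding p_def param_formulas_def \<alpha>_def \<beta>_def by auto
  moreover have "finitely_satisfiable X E p"
    unfolding finitely_satisfiable_def
  proof (intro allI impI, elim conjE)
    fix q assume q: "q \<subseteq> p" "finite q"
    obtain U' where U': "U' \<subseteq> U" "finite U'" "q \<inter> \<alpha> ` U = \<alpha> ` U'"
      using finite_subset_image[of "q \<inter> \<alpha> ` U" \<alpha> U] q(2) by blast
    obtain V' where V': "V' \<subseteq> V" "finite V'" "q \<inter> \<beta> ` V = \<beta> ` V'"
      using finite_subset_image[of "q \<inter> \<beta> ` V" \<beta> V] q(2) by blast
    have "q = \<alpha> ` U' \<union> \<beta> ` V'" using q(1) U'(3) V'(3) unfolding p_def by blast
    moreover have "U' \<subseteq> X" "V' \<subseteq> X" "U' \<inter> V' = {}" using U'(1) V'(1) UV(1-3) by blast+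
    ultimately show "\<exists>c. realizes X E c q"
      using rado_theory_finite_extension[OF mod U'(2) V'(2)] realizes_iff by blast
  qed
  ultimately have "\<exists>q. p \<subseteq> q \<and> complete_type X E (U \<union> V) q"
    by (rule finitely_satisfiable_extends_to_complete_type)
  then obtain q where q: "p \<subseteq> q" "complete_type X E (U \<union> V) q" by blast
  then obtain c where "realizes X E c q"
    using sat small UV(1,2) unfolding saturated_def by (meson Un_least)
  then have "realizes X E c p" using q(1) unfolding realizes_def by blast
  then show "\<exists>z\<in>X. z \<notin> U \<union> V \<and> (\<forall>u\<in>U. E z u) \<and> (\<forall>v\<in>V. \<not> E z v)"
    unfolding p_def realizes_iff by blast
qed


section \<open>Sunflowerability\<close>

lemma isomorphic_sym:
  assumes "isomorphic X E Y F"
  shows "isomorphic Y F X E"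
proof -
  obtain f where f: "bij_betw f X Y" "\<And>x y. x \<in> X \<Longrightarrow> y \<in> X \<Longrightarrow> E x y \<longleftrightarrow> F (f x) (f y)"
    using assms unfolding isomorphic_def by blast
  let ?g = "inv_into X f"
  have "bij_betw ?g Y X" using f(1) by (rule bij_betw_inv_into)
  moreover have "F x y \<longleftrightarrow> E (?g x) (?g y)" if "x \<in> Y" "y \<in> Y" for x y
    using f(2)[of "?g x" "?g y"] that f(1) bij_betw_inv_into_right[OF f(1)]
      bij_betwE[OF calculation] by auto
  ultimately show ?thesis unfolding isomorphic_def by blast
qed

lemma isomorphic_trans:
  assumes "isomorphic X E Y F" "isomorphic Y F Z G"
  shows "isomorphic X E Z G"
proof -
  obtain f where f: "bij_betw f X Y" "\<And>x y. x \<in> X \<Longrightarrow> y \<in> X \<Longrightarrow> E x y \<longleftrightarrow> F (f x) (f y)"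
    using assms(1) unfolding isomorphic_def by blast
  obtain g where g: "bij_betw g Y Z" "\<And>x y. x \<in> Y \<Longrightarrow> y \<in> Y \<Longrightarrow> F x y \<longleftrightarrow> G (g x) (g y)"
    using assms(2) unfolding isomorphic_def by blast
  have "E x y \<longleftrightarrow> G ((g \<circ> f) x) ((g \<circ> f) y)" if "x \<in> X" "y \<in> X" for x y
    using f(2)[OF that] g(2)[of "f x" "f y"] bij_betwE[OF f(1)] that by simp
  then show ?thesis
    using bij_betw_trans[OF f(1) g(1)] unfolding isomorphic_def by blast
qed

theorem lemma2p19:
  fixes \<kappa> :: "'k rel" and X :: "'a set" and E :: "'a \<Rightarrow> 'a \<Rightarrow> bool"
  assumes "Cinfinite \<kappa>"
    and "regularCard \<kappa>"
    and "models X E rado_theory"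
    and "saturated \<kappa> X E"
    and "|X| =o \<kappa>"
  shows "sunflowerable TYPE('b) X E"
  unfolding sunflowerable_def n_sunflowerable_def
proof (intro allI conjI impI; (elim conjE)?)
  show "infinite X"
    using assms(1,5) finite_ordLess_Cinfinite not_ordLess_ordIso by blast
next
  fix n and Y :: "'b set set" and F
  assume Y: "\<forall>p\<in>Y. finite p \<and> card p = n" and iso: "isomorphic Y F X E"
  have iso': "isomorphic X E Y F" by (rule isomorphic_sym[OF iso])
  \<comment> \<open>The isomorphism labels each vertex of \<open>X\<close> with an
    \<open>n\<close>-element set.\<close>
  then obtain f where f: "bij_betw f X Y"
      "\<And>x y. x \<in> X \<Longrightarrow> y \<in> X \<Longrightarrow> E x y \<longleftrightarrow> F (f x) (f y)"
    unfolding isomorphic_def by blast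
  have lab: "finite (f x) \<and> card (f x) = n" if "x \<in> X" for x
    using Y bij_betwE[OF f(1)] that by blast
  have "\<exists>g r. graph_embedding X E X g \<and> (\<forall>x\<in>X. \<forall>y\<in>X. x \<noteq> y \<longrightarrow> f (g x) \<inter> f (g y) = r)"
    by (rule sunflower_embedding[OF assms(1,2,5) rado_theory_sym[OF assms(3)]
          rado_theory_irrefl[OF assms(3)] order_refl
          saturated_rado_extension_property[OF assms(1,3,4)] lab])
  then obtain g r where g: "graph_embedding X E X g"
      "\<forall>x\<in>X. \<forall>y\<in>X. x \<noteq> y \<longrightarrow> f (g x) \<inter> f (g y) = r"
    by blast
  have gX: "g ` X \<subseteq> X" "inj_on g X" "\<And>x y. x \<in> X \<Longrightarrow> y \<in> X \<Longrightarrow> E x y \<longleftrightarrow> E (g x) (g y)"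
    using g(1) unfolding graph_embedding_def by blast+
  \<comment> \<open>\<open>g\<close> finds a copy of the graph inside \<open>X\<close> with
    sunflower labels, and \<open>f\<close> carries this copy into \<open>Y\<close>.\<close>
  let ?Z = "(f \<circ> g) ` X"
  have "inj_on (f \<circ> g) X"
    using gX(1,2) f(1) by (meson bij_betw_def comp_inj_on inj_on_subset)
  moreover have "E x y \<longleftrightarrow> F ((f \<circ> g) x) ((f \<circ> g) y)" if "x \<in> X" "y \<in> X" for x y
    using gX(3)[OF that] f(2)[of "g x" "g y"] gX(1) that by auto
  ultimately have "isomorphic X E ?Z F"
    unfolding isomorphic_def bij_betw_def by blast
  then have "isomorphic ?Z F Y F"
    using isomorphic_sym isomorphic_trans iso' by blast
  moreover have ZY: "?Z \<subseteq> Y" using gX(1) bij_betwE[OF f(1)] by auto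
  moreover have "sunflower ?Z"
    unfolding sunflower_def
  proof (intro conjI exI[of _ r] ballI impI)
    show "finite p" if "p \<in> ?Z" for p using that ZY Y by blast
    show "p \<inter> q = r" if "p \<in> ?Z" "q \<in> ?Z" "p \<noteq> q" for p q
      using that g(2) by auto
  qed
  ultimately show "\<exists>Z\<subseteq>Y. isomorphic Z F Y F \<and> sunflower Z" by blast
qed

end
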